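(* Let $(H, \preceq)$ be a premon such that every $\preceq$-irreducible has finite $\preceq$-height (this holds, in particular, if every $\preceq$-irreducible is a $\preceq$-quark). Then $H$ is a $\preceq$-factorable monoid if and only if $H$ is locally $\preceq$-artinian.
   Context: A premon is a pair $(H, \preceq)$ consisting of a (multiplicatively written, not necessarily commutative) monoid $H$ with identity $1_H$ and a preorder $\preceq$ (a reflexive and transitive binary relation) on the carrier set of $H$; no compatibility between the operation and the preorder is assumed. Write $x \prec y$ if $x \preceq y$ and $y \not\preceq x$. An element $u \in H$ is a $\preceq$-unit if $u \preceq 1_H \preceq u$, and a $\preceq$-non-unit otherwise. A $\preceq$-quark is a $\preceq$-non-unit $a \in H$ such that there is no $\preceq$-non-unit $b \in H$ with $b \prec a$. A $\preceq$-irreducible is a $\preceq$-non-unit $a \in H$ such that $a \ne xy$ for all $\preceq$-non-units $x, y \in H$ with $x \prec a$ and $y \prec a$. The $\preceq$-height of an element $x \in H$ is the supremum of the set of all integers $n \ge 1$ for which there are $\preceq$-non-units $x_1, \ldots, x_n \in H$ with $x_1 = x$ and $x_{i+1} \prec x_i$ for each $i = 1, \ldots, n-1$, where $\sup \emptyset := 0$. An element $x \in H$ is $\preceq$-artinian if there is no infinite sequence $x_1, x_2, \ldots$ in $H$ with $x_1 = x$ and $x_{i+1} \prec x_i$ for all $i \ge 1$. The monoid $H$ is locally $\preceq$-artinian if every $\preceq$-non-unit is a product of finitely many $\preceq$-artinian $\preceq$-non-units. The monoid $H$ is $\preceq$-factorable if every $\preceq$-non-unit is a product of finitely many $\preceq$-irreducibles.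 *)

theory Defs
  imports "HOL-Algebra.Group" "HOL-Library.Extended_Nat"
begin

definition premon :: "('a, 'b) monoid_scheme \<Rightarrow> 'a rel \<Rightarrow> bool" where
  "premon H R \<longleftrightarrow> monoid H \<and> preorder_on (carrier H) R"

definition prec :: "'a rel \<Rightarrow> 'a \<Rightarrow> 'a \<Rightarrow> bool" where
  "prec R x y \<longleftrightarrow> (x, y) \<in> R \<and> (y, x) \<notin> R"

definition premon_unit :: "('a, 'b) monoid_scheme \<Rightarrow> 'a rel \<Rightarrow> 'a \<Rightarrow> bool" where
  "premon_unit H R u \<longleftrightarrow> u \<in> carrier H \<and> (u, \<one>\<^bsub>H\<^esub>) \<in> R \<and> (\<one>\<^bsub>H\<^esub>, u) \<in> R"

definition premon_nonunit :: "('a, 'b) monoid_scheme \<Rightarrow> 'a rel \<Rightarrow> 'a \<Rightarrow> bool" where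
  "premon_nonunit H R u \<longleftrightarrow> u \<in> carrier H \<and> \<not> premon_unit H R u"

definition premon_quark :: "('a, 'b) monoid_scheme \<Rightarrow> 'a rel \<Rightarrow> 'a \<Rightarrow> bool" where
  "premon_quark H R a \<longleftrightarrow>
     premon_nonunit H R a \<and> (\<nexists>b. premon_nonunit H R b \<and> prec R b a)"

definition premon_irreducible :: "('a, 'b) monoid_scheme \<Rightarrow> 'a rel \<Rightarrow> 'a \<Rightarrow> bool" where
  "premon_irreducible H R a \<longleftrightarrow>
     premon_nonunit H R a \<and>
     (\<forall>x y. premon_nonunit H R x \<and> premon_nonunit H R y \<and> prec R x a \<and> prec R y a
        \<longrightarrow> a \<noteq> x \<otimes>\<^bsub>H\<^esub> y)"

text \<open>The supremum is taken in the extended naturals, where the supremum of the empty set is 0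
  and that of an infinite set is \<open>\<infinity>\<close>.\<close>

definition premon_height :: "('a, 'b) monoid_scheme \<Rightarrow> 'a rel \<Rightarrow> 'a \<Rightarrow> enat" where
  "premon_height H R a =
     Sup {enat n | n. n \<ge> 1 \<and>
       (\<exists>x :: nat \<Rightarrow> 'a. (\<forall>i\<in>{1..n}. premon_nonunit H R (x i)) \<and> x 1 = a \<and>
          (\<forall>i\<in>{1..<n}. prec R (x (Suc i)) (x i)))}"

definition premon_artinian :: "('a, 'b) monoid_scheme \<Rightarrow> 'a rel \<Rightarrow> 'a \<Rightarrow> bool" where
  "premon_artinian H R a \<longleftrightarrow>
     a \<in> carrier H \<and>
     (\<nexists>x :: nat \<Rightarrow> 'a. (\<forall>i\<ge>1. x i \<in> carrier H) \<and> x 1 = a \<and> (\<forall>i\<ge>1. prec R (x (Suc i)) (x i)))"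

text \<open>The empty list is harmless below: its product is the identity, which is never a non-unit.\<close>

definition finite_product_of :: "('a, 'b) monoid_scheme \<Rightarrow> ('a \<Rightarrow> bool) \<Rightarrow> 'a \<Rightarrow> bool" where
  "finite_product_of H P a \<longleftrightarrow>
     (\<exists>xs. (\<forall>x\<in>set xs. P x) \<and> a = foldr (\<otimes>\<^bsub>H\<^esub>) xs \<one>\<^bsub>H\<^esub>)"

definition locally_artinian :: "('a, 'b) monoid_scheme \<Rightarrow> 'a rel \<Rightarrow> bool" where
  "locally_artinian H R \<longleftrightarrow>
     (\<forall>a. premon_nonunit H R a \<longrightarrow>
        finite_product_of H (\<lambda>x. premon_artinian H R x \<and> premon_nonunit H R x) a)"

definition premon_factorable :: "('a, 'b) monoid_scheme \<Rightarrow> 'a rel \<Rightarrow> bool" where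
  "premon_factorable H R \<longleftrightarrow>
     (\<forall>a. premon_nonunit H R a \<longrightarrow> finite_product_of H (premon_irreducible H R) a)"

end

theory Submission
  imports Defs
begin

text \<open>
  Going down from an artinian non-unit must stop, so splitting it repeatedly into strictly smaller
  non-units ends in irreducibles (\<open>artinian_nonunit_factors\<close>), and a product of artinian
  non-units becomes a product of irreducibles factor by factor. Conversely, an irreducible
  of finite height is artinian (\<open>artinian_if_finite_height\<close>), so a factorization into irreducibles
  already is one into artinian non-units.

  The one subtlety is that the height counts chains of non-units, whereas an infinite descending
  sequence that refutes the artinian property may pass through units. Units are equivalent to the
  identity, hence to each other, so such a sequence contains at most one unit; skipping it
  leaves arbitrarily long chains of non-units from the same starting point.

  A chain of non-units that starts at a quark cannot be continued, so quarks have height at most 1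
  and fall under the finiteness hypothesis.
\<close>

lemma prec_trans:
  assumes "trans R" "prec R x y" "prec R y z"
  shows "prec R x z"
  using assms unfolding prec_def by (meson transD)

lemma descending_prec:
  assumes "trans R" and step: "\<And>i. i \<ge> (1::nat) \<Longrightarrow> prec R (x (Suc i)) (x i)"
    and "1 \<le> i" "i < j"
  shows "prec R (x j) (x i)"
  using \<open>i < j\<close>
proof (induction j)
  case (Suc j)
  then show ?case
    using prec_trans[OF \<open>trans R\<close> step Suc.IH] step[of i] \<open>1 \<le> i\<close>
    by (cases "i = j") auto
qed simp

lemma units_not_prec:
  assumes "trans R" "premon_unit H R u" "premon_unit H R v"
  shows "\<not> prec R u v"
  using assms unfolding premon_unit_def prec_def by (meson transD)

lemma height_ge:
  assumes "n \<ge> 1" "\<forall>i\<in>{1..n}. premon_nonunit H R (x i)" "x 1 = a"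
    and "\<forall>i\<in>{1..<n}. prec R (x (Suc i)) (x i)"
  shows "enat n \<le> premon_height H R a"
  unfolding premon_height_def by (rule Sup_upper) (use assms in blast)

lemma height_infinite_if_descending_nonunits:
  assumes "\<And>i. i \<ge> 1 \<Longrightarrow> premon_nonunit H R (x i)" "x 1 = a"
    and "\<And>i. i \<ge> (1::nat) \<Longrightarrow> prec R (x (Suc i)) (x i)"
  shows "premon_height H R a = \<infinity>"
proof (rule ccontr)
  assume "premon_height H R a \<noteq> \<infinity>"
  then obtain m where "premon_height H R a = enat m" by auto
  moreover have "enat (Suc m) \<le> premon_height H R a"
    by (rule height_ge[of _ _ _ x]) (use assms in auto)
  ultimately show False by simp
qed

text \<open>A sequence that descends from a non-unit is reindexed so as to skip the only unit that it can
  contain; what remains witnesses infinite height.\<close>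

lemma artinian_if_finite_height:
  assumes "trans R" and a: "premon_nonunit H R a" and fin: "premon_height H R a < \<infinity>"
  shows "premon_artinian H R a"
proof (rule ccontr)
  assume "\<not> premon_artinian H R a"
  then obtain x :: "nat \<Rightarrow> 'a"
    where carr: "\<And>i. i \<ge> 1 \<Longrightarrow> x i \<in> carrier H" and x1: "x 1 = a"
      and step: "\<And>i. i \<ge> 1 \<Longrightarrow> prec R (x (Suc i)) (x i)"
    using a unfolding premon_artinian_def premon_nonunit_def by auto
  have desc: "prec R (x j) (x i)" if "1 \<le> i" "i < j" for i j
    using descending_prec[of R x, OF \<open>trans R\<close> step] that by blast
  have one_unit: "i = j"
    if "1 \<le> i" "1 \<le> j" "premon_unit H R (x i)" "premon_unit H R (x j)" for i j
    using that desc units_not_prec[OF \<open>trans R\<close>] by (metis nat_neq_iff)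
  define g where
    "g i = (if \<exists>k\<in>{1..i}. premon_unit H R (x k) then Suc i else i)" for i :: nat
  have g_ge: "g i \<ge> i" for i by (simp add: g_def)
  have g_mono: "g i < g (Suc i)" for i
    unfolding g_def by (auto intro: le_SucI)
  have "premon_nonunit H R (x (g i))" if "i \<ge> 1" for i
  proof -
    have "\<not> premon_unit H R (x (g i))"
    proof (cases "\<exists>k\<in>{1..i}. premon_unit H R (x k)")
      case True
      then obtain k where "1 \<le> k" "k \<le> i" "premon_unit H R (x k)" by auto
      then show ?thesis using True one_unit[of k "Suc i"] by (auto simp: g_def)
    next
      case False
      then show ?thesis using that by (auto simp: g_def)
    qed
    then show ?thesis
      using carr[of "g i"] g_ge[of i] that by (auto simp: premon_nonunit_def)
  qed
  moreover have "x (g 1) = a"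
    using a x1 by (auto simp: g_def premon_nonunit_def)
  moreover have "prec R (x (g (Suc i))) (x (g i))" if "i \<ge> 1" for i
    using desc[OF _ g_mono] g_ge[of i] that by simp
  ultimately have "premon_height H R a = \<infinity>"
    by (rule height_infinite_if_descending_nonunits)
  with fin show False by simp
qed

lemma quark_height_le_1:
  assumes "premon_quark H R a"
  shows "premon_height H R a \<le> 1"
  unfolding premon_height_def
proof (rule Sup_least, clarify)
  fix n and x :: "nat \<Rightarrow> 'a"
  assume "\<forall>i\<in>{1..n}. premon_nonunit H R (x i)" "a = x 1"
    and "\<forall>i\<in>{1..<n}. prec R (x (Suc i)) (x i)"
  then have "n \<le> 1" using assms unfolding premon_quark_def by force
  then show "enat n \<le> 1" by (simp add: one_enat_def)
qed

lemma (in monoid) foldr_mult_append: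
  assumes "set xs \<subseteq> carrier G" "set ys \<subseteq> carrier G"
  shows "foldr (\<otimes>) (xs @ ys) \<one> = foldr (\<otimes>) xs \<one> \<otimes> foldr (\<otimes>) ys \<one>"
proof -
  have closed: "foldr (\<otimes>) zs \<one> \<in> carrier G" if "set zs \<subseteq> carrier G" for zs
    using that by (induction zs) auto
  show ?thesis
    using assms by (induction xs) (auto simp: closed m_assoc simp del: foldr_append)
qed

lemma finite_product_of_mult:
  assumes "monoid H" and carr: "\<And>x. P x \<Longrightarrow> x \<in> carrier H"
    and "finite_product_of H P a" "finite_product_of H P b"
  shows "finite_product_of H P (a \<otimes>\<^bsub>H\<^esub> b)"
proof -
  obtain xs ys where "\<forall>x\<in>set xs. P x" "a = foldr (\<otimes>\<^bsub>H\<^esub>) xs \<one>\<^bsub>H\<^esub>"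
    and "\<forall>x\<in>set ys. P x" "b = foldr (\<otimes>\<^bsub>H\<^esub>) ys \<one>\<^bsub>H\<^esub>"
    using assms(3,4) unfolding finite_product_of_def by blast
  then show ?thesis
    using monoid.foldr_mult_append[OF \<open>monoid H\<close>, of xs ys] carr
    unfolding finite_product_of_def
    by (intro exI[of _ "xs @ ys"]) (auto simp: subset_iff simp del: foldr_append)
qed

lemma finite_product_of_self:
  assumes "monoid H" "P a" "a \<in> carrier H"
  shows "finite_product_of H P a"
  unfolding finite_product_of_def
  by (intro exI[of _ "[a]"]) (use assms in \<open>simp add: monoid.r_one\<close>)

lemma finite_product_of_one: "finite_product_of H P \<one>\<^bsub>H\<^esub>"
  unfolding finite_product_of_def by (intro exI[of _ "[]"]) simp

lemma finite_product_of_flatten: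
  assumes "monoid H" and carr: "\<And>x. Q x \<Longrightarrow> x \<in> carrier H"
    and "finite_product_of H P a" and PQ: "\<And>x. P x \<Longrightarrow> finite_product_of H Q x"
  shows "finite_product_of H Q a"
proof -
  obtain xs where "\<forall>x\<in>set xs. P x" "a = foldr (\<otimes>\<^bsub>H\<^esub>) xs \<one>\<^bsub>H\<^esub>"
    using assms(3) unfolding finite_product_of_def by blast
  then show ?thesis
  proof (induction xs arbitrary: a)
    case Nil
    then show ?case by (simp add: finite_product_of_one)
  next
    case (Cons x xs)
    then have "finite_product_of H Q (foldr (\<otimes>\<^bsub>H\<^esub>) xs \<one>\<^bsub>H\<^esub>)" by simp
    then show ?case
      using Cons.prems finite_product_of_mult[OF \<open>monoid H\<close> carr PQ] by simp
  qed
qed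

text \<open>If the non-unit \<open>a\<close> did not factor, then it would not be irreducible, so \<open>a = x \<otimes> y\<close> with
  non-units \<open>x, y\<close> strictly below \<open>a\<close>, and one of them would again not factor. Repeating
  this yields an infinite descending sequence. Only the starting point has to be artinian,
  because the whole sequence is built from it.\<close>

lemma artinian_nonunit_factors:
  assumes "monoid H" and art: "premon_artinian H R a" and non: "premon_nonunit H R a"
  shows "finite_product_of H (premon_irreducible H R) a"
proof (rule ccontr)
  define bad where
    "bad b \<longleftrightarrow> premon_nonunit H R b \<and> \<not> finite_product_of H (premon_irreducible H R) b" for b
  have carr: "x \<in> carrier H" if "premon_irreducible H R x" for x
    using that by (simp add: premon_irreducible_def premon_nonunit_def)
  have descend: "\<exists>c. bad c \<and> prec R c b" if b: "bad b" for b
  proof -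
    have "\<not> premon_irreducible H R b"
      using b finite_product_of_self[OF \<open>monoid H\<close>] carr unfolding bad_def by blast
    then obtain x y where "premon_nonunit H R x" "premon_nonunit H R y"
      "prec R x b" "prec R y b" "b = x \<otimes>\<^bsub>H\<^esub> y"
      using b unfolding premon_irreducible_def bad_def by blast
    with b show ?thesis
      using finite_product_of_mult[OF \<open>monoid H\<close> carr] unfolding bad_def by blast
  qed
  assume "\<not> finite_product_of H (premon_irreducible H R) a"
  with non have "bad a" by (simp add: bad_def)
  then obtain f :: "nat \<Rightarrow> 'a"
    where f: "\<And>n. bad (f n) \<and> (n = 0 \<longrightarrow> f n = a)" "\<And>n. prec R (f (Suc n)) (f n)"
    using dependent_nat_choice
      [of "\<lambda>n b. bad b \<and> (n = 0 \<longrightarrow> b = a)" "\<lambda>_ b c. prec R c b"] descend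
    by blast
  \<comment> \<open>The sequences that the artinian property excludes are indexed from 1.\<close>
  define x where "x i = f (i - 1)" for i
  have "x i \<in> carrier H" for i
    using f(1) by (simp add: x_def bad_def premon_nonunit_def)
  moreover have "x 1 = a"
    using f(1)[of 0] by (simp add: x_def)
  moreover have "prec R (x (Suc i)) (x i)" if "i \<ge> 1" for i
    using f(2)[of "i - 1"] that by (simp add: x_def)
  ultimately show False
    using art unfolding premon_artinian_def by blast
qed

lemma factorable_if_locally_artinian:
  assumes "monoid H" "locally_artinian H R"
  shows "premon_factorable H R"
  unfolding premon_factorable_def
proof (intro allI impI)
  fix a
  assume "premon_nonunit H R a"
  then have "finite_product_of H (\<lambda>x. premon_artinian H R x \<and> premon_nonunit H R x) a"
    using assms(2) by (simp add: locally_artinian_def)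
  then show "finite_product_of H (premon_irreducible H R) a"
    by (rule finite_product_of_flatten[OF \<open>monoid H\<close>, rotated])
      (auto simp: premon_irreducible_def premon_nonunit_def
        intro: artinian_nonunit_factors[OF \<open>monoid H\<close>, unfolded premon_nonunit_def])
qed

lemma locally_artinian_if_factorable:
  assumes "trans R" and fin: "\<And>a. premon_irreducible H R a \<Longrightarrow> premon_height H R a < \<infinity>"
    and fact: "premon_factorable H R"
  shows "locally_artinian H R"
proof -
  have "premon_artinian H R x \<and> premon_nonunit H R x" if "premon_irreducible H R x" for x
    using that artinian_if_finite_height[OF \<open>trans R\<close> _ fin]
    by (auto simp: premon_irreducible_def)
  with fact show ?thesis
    unfolding locally_artinian_def premon_factorable_def finite_product_of_def by meson
qed

theorem corollary2p5:
  fixes H :: "('a, 'b) monoid_scheme" and R :: "'a rel"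
  assumes "premon H R"
  shows "((\<forall>a. premon_irreducible H R a \<longrightarrow> premon_height H R a < \<infinity>) \<longrightarrow>
            (premon_factorable H R \<longleftrightarrow> locally_artinian H R)) \<and>
         ((\<forall>a. premon_irreducible H R a \<longrightarrow> premon_quark H R a) \<longrightarrow>
            (\<forall>a. premon_irreducible H R a \<longrightarrow> premon_height H R a < \<infinity>))"
proof -
  have "monoid H" "trans R"
    using assms by (auto simp: premon_def preorder_on_def)
  moreover have "premon_height H R a < \<infinity>" if "premon_quark H R a" for a
    using quark_height_le_1[OF that] by (rule le_less_trans) (simp add: one_enat_def)
  ultimately show ?thesis
    using factorable_if_locally_artinian locally_artinian_if_factorable by blast
qed

end
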